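(* Let $K\ge2$, $\beta\ge1$, assume $n/(\beta K)\ge2$ (so that each class contains at least two vertices), fix $(a,b)$, and let $\Theta=\Theta(n,K,a,b,\beta)$ be the corresponding homogeneous SBM family. Let $M$ be an $\varepsilon$-node-DP mechanism with output $M(A)\in[K]^n$, and let $$\delta(M):=\sup_{\theta\in\Theta}\mathbb P_\theta\big(r(\sigma_\theta,M(A))>0\big),\qquad R(M):=\sup_{\theta\in\Theta}\mathbb E_\theta\big[r(\sigma_\theta,M(A))\big].$$ For any constant $c>0$: (i) If $M$ achieves polynomially small exact-recovery failure, $\delta(M)\le n^{-c}$, then necessarily $$\varepsilon\ge\tfrac12\log(n^c-1)\ge\tfrac c2\log n-\tfrac12\log2,$$ so $\varepsilon=\Omega(\log n)$. (ii) If $M$ achieves polynomially small expected mismatch, $R(M)\le n^{-(1+c)}$, then necessarily $$\varepsilon\ge\tfrac12\log(n^c-1)\ge\tfrac c2\log n-\tfrac12\log2,$$ so again $\varepsilon=\Omega(\log n)$.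
   Context: Graphs on $[n]=\{1,\dots,n\}$ are identified with symmetric zero-diagonal matrices $A\in\{0,1\}^{n\times n}$. $A\sim_v A'$ (node-adjacent) if $A,A'$ differ only in the incident edges of a single vertex $v$. A randomized mechanism $M$ on graphs is $\varepsilon$-node-DP ($\varepsilon>0$) if $\mathbb P(M(A)\in S)\le e^{\varepsilon}\,\mathbb P(M(A')\in S)$ for all measurable $S$ and all $A\sim_v A'$. $\Sigma_\beta$ is the set of $\sigma:[n]\to[K]$ with $\frac{n}{\beta K}\le|\{i:\sigma(i)=k\}|\le\frac{\beta n}{K}$ for all $k\in[K]$. For $\sigma_0\in\Sigma_\beta$ and $n\ge a>b\ge0$, $\mathrm{SBM}(\sigma_0)$ is the law of the random graph whose entries $A_{ij}$, $i<j$, are independent with $\mathbb P(A_{ij}=1)=a/n$ if $\sigma_0(i)=\sigma_0(j)$ and $b/n$ otherwise. $\Theta(n,K,a,b,\beta)$ is the family of these models, $\sigma_0\in\Sigma_\beta$; each $\theta$ corresponds to a labeling $\sigma_\theta\in\Sigma_\beta$ determined up to permutation of the labels $[K]$, and an arbitrary representative is fixed. $\mathbb P_\theta,\mathbb E_\theta$ are probability and expectation when $A$ is drawn from the model $\theta$ (including the randomness of $M$). $r(\sigma,\hat\sigma):=\min_{\pi\in S_K}\frac1n\sum_{i=1}^n\mathbf 1\{\sigma(i)\ne\pi(\hat\sigma(i))\}$, with $S_K$ the permutations of $[K]$. Logarithms are natural, and $\Omega(\cdot)$ is used in its standard asymptotic sense.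
   Formalization: The middle inequality ½log(n^c−1) ≥ (c/2)log n − ½log 2 is stated only for n^c ≥ 2, since it is false for n^c < 2 (e.g. n=4, c=0.1); both lower bounds on ε are proved without this condition. Θ is assumed nonempty so that the suprema make sense. *)

theory Defs
  imports "HOL-Probability.Probability" "HOL-Combinatorics.Permutations"
    "HOL-Library.Landau_Symbols"
begin

(* Matrices and labelings are functions on nat that take a fixed default value off the index
   range (0 for matrices, undefined for labelings), so that equality of functions is equality
   of matrices and labelings on {1..n}. *)

type_synonym graph = "nat \<Rightarrow> nat \<Rightarrow> nat"
type_synonym labeling = "nat \<Rightarrow> nat"

definition graphs :: "nat \<Rightarrow> graph set" where
  "graphs n = {A. (\<forall>i j. A i j \<in> {0, 1}) \<and> (\<forall>i j. A i j = A j i) \<and> (\<forall>i. A i i = 0) \<and>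
                  (\<forall>i j. A i j \<noteq> 0 \<longrightarrow> i \<in> {1..n} \<and> j \<in> {1..n})}"

definition node_adjacent :: "nat \<Rightarrow> graph \<Rightarrow> graph \<Rightarrow> bool" where
  "node_adjacent v A A' \<longleftrightarrow> (\<forall>i j. i \<noteq> v \<longrightarrow> j \<noteq> v \<longrightarrow> A i j = A' i j)"

definition labelings :: "nat \<Rightarrow> nat \<Rightarrow> labeling set" where
  "labelings n K = {1..n} \<rightarrow>\<^sub>E {1..K}"

(* The output space of a mechanism is the finite discrete set labelings n K, so output laws are
   pmfs and every set S of labelings is measurable. *)

definition mechanism :: "nat \<Rightarrow> nat \<Rightarrow> (graph \<Rightarrow> labeling pmf) \<Rightarrow> bool" where
  "mechanism n K M \<longleftrightarrow> (\<forall>A\<in>graphs n. set_pmf (M A) \<subseteq> labelings n K)"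

definition node_dp :: "nat \<Rightarrow> real \<Rightarrow> (graph \<Rightarrow> labeling pmf) \<Rightarrow> bool" where
  "node_dp n \<epsilon> M \<longleftrightarrow> \<epsilon> > 0 \<and>
     (\<forall>v\<in>{1..n}. \<forall>A\<in>graphs n. \<forall>A'\<in>graphs n. node_adjacent v A A' \<longrightarrow>
        (\<forall>S. measure_pmf.prob (M A) S \<le> exp \<epsilon> * measure_pmf.prob (M A') S))"

definition balanced_labelings :: "nat \<Rightarrow> nat \<Rightarrow> real \<Rightarrow> labeling set" where
  "balanced_labelings n K \<beta> = {\<sigma> \<in> labelings n K. \<forall>k\<in>{1..K}.
     real n / (\<beta> * real K) \<le> real (card {i\<in>{1..n}. \<sigma> i = k}) \<and>
     real (card {i\<in>{1..n}. \<sigma> i = k}) \<le> \<beta> * real n / real K}"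

(* Independent Bernoulli edges for i < j, then symmetrized; X is False off the pairs
   1 <= i < j <= n, which makes the diagonal and the entries outside the range 0. *)

definition sbm :: "nat \<Rightarrow> real \<Rightarrow> real \<Rightarrow> labeling \<Rightarrow> graph pmf" where
  "sbm n a b \<sigma> =
     map_pmf (\<lambda>X i j. of_bool (X (min i j, max i j)))
       (Pi_pmf {(i, j). 1 \<le> i \<and> i < j \<and> j \<le> n} False
         (\<lambda>(i, j). bernoulli_pmf (if \<sigma> i = \<sigma> j then a / real n else b / real n)))"

definition sbm_family :: "nat \<Rightarrow> nat \<Rightarrow> real \<Rightarrow> real \<Rightarrow> real \<Rightarrow> graph pmf set" where
  "sbm_family n K a b \<beta> = sbm n a b ` balanced_labelings n K \<beta>"

(* An arbitrary choice of a representative labeling for each model of the family. *)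

definition label_choice ::
  "nat \<Rightarrow> nat \<Rightarrow> real \<Rightarrow> real \<Rightarrow> real \<Rightarrow> (graph pmf \<Rightarrow> labeling) \<Rightarrow> bool" where
  "label_choice n K a b \<beta> \<sigma> \<longleftrightarrow>
     (\<forall>\<theta>\<in>sbm_family n K a b \<beta>. \<sigma> \<theta> \<in> balanced_labelings n K \<beta> \<and> sbm n a b (\<sigma> \<theta>) = \<theta>)"

definition mismatch :: "nat \<Rightarrow> nat \<Rightarrow> labeling \<Rightarrow> labeling \<Rightarrow> real" where
  "mismatch n K \<sigma> \<sigma>' =
     Min ((\<lambda>\<pi>. 1 / real n * (\<Sum>i=1..n. of_bool (\<sigma> i \<noteq> \<pi> (\<sigma>' i)))) ` {\<pi>. \<pi> permutes {1..K}})"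

(* bind_pmf \<theta> M is the law of M(A) when A is drawn from \<theta>. *)

definition exact_failure :: "nat \<Rightarrow> nat \<Rightarrow> real \<Rightarrow> real \<Rightarrow> real \<Rightarrow> (graph pmf \<Rightarrow> labeling) \<Rightarrow>
    (graph \<Rightarrow> labeling pmf) \<Rightarrow> real" where
  "exact_failure n K a b \<beta> \<sigma> M =
     (SUP \<theta>\<in>sbm_family n K a b \<beta>.
        measure_pmf.prob (bind_pmf \<theta> M) {\<tau>. mismatch n K (\<sigma> \<theta>) \<tau> > 0})"

definition max_risk :: "nat \<Rightarrow> nat \<Rightarrow> real \<Rightarrow> real \<Rightarrow> real \<Rightarrow> (graph pmf \<Rightarrow> labeling) \<Rightarrow>
    (graph \<Rightarrow> labeling pmf) \<Rightarrow> real" where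
  "max_risk n K a b \<beta> \<sigma> M =
     (SUP \<theta>\<in>sbm_family n K a b \<beta>.
        measure_pmf.expectation (bind_pmf \<theta> M) (mismatch n K (\<sigma> \<theta>)))"

(* Nonemptiness of the family is not automatic (take \<beta> = 1 and K not dividing n), and without
   it the suprema above are suprema of the empty set. *)

definition sbm_setting :: "nat \<Rightarrow> nat \<Rightarrow> real \<Rightarrow> real \<Rightarrow> real \<Rightarrow> (graph pmf \<Rightarrow> labeling) \<Rightarrow>
    real \<Rightarrow> (graph \<Rightarrow> labeling pmf) \<Rightarrow> bool" where
  "sbm_setting n K a b \<beta> \<sigma> \<epsilon> M \<longleftrightarrow>
     K \<ge> 2 \<and> \<beta> \<ge> 1 \<and> real n / (\<beta> * real K) \<ge> 2 \<and>
     real n \<ge> a \<and> a > b \<and> b \<ge> 0 \<and>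
     sbm_family n K a b \<beta> \<noteq> {} \<and> label_choice n K a b \<beta> \<sigma> \<and>
     mechanism n K M \<and> node_dp n \<epsilon> M"

end

theory Submission
  imports Defs
begin

text \<open>
  Swap the labels of two vertices of different classes of a balanced labeling. Since classes have
  at least two elements, the resulting partition differs from the original one, so no output is
  exactly correct for both models. On the other hand the two random graphs can be coupled so that
  they differ only in edges at the two swapped vertices; two applications of node-DP then give
  \<open>1 - \<delta> \<le> exp (2 * \<epsilon>) * \<delta>\<close>. The risk bound reduces to this by Markov's inequality, because a
  positive mismatch is at least \<open>1 / n\<close>.
\<close>

section \<open>Mixtures and couplings of discrete laws\<close>

lemma prob_bind_pmf:
  "measure_pmf.prob (bind_pmf p M) S = measure_pmf.expectation p (\<lambda>x. measure_pmf.prob (M x) S)"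
proof -
  have "ennreal (measure_pmf.prob (bind_pmf p M) S) = (\<integral>\<^sup>+x. emeasure (M x) S \<partial>p)"
    by (simp flip: measure_pmf.emeasure_eq_measure add: emeasure_bind_pmf)
  also have "\<dots> = (\<integral>\<^sup>+x. ennreal (measure_pmf.prob (M x) S) \<partial>p)"
    by (simp add: measure_pmf.emeasure_eq_measure)
  also have "\<dots> = ennreal (measure_pmf.expectation p (\<lambda>x. measure_pmf.prob (M x) S))"
    by (intro nn_integral_eq_integral measure_pmf.integrable_const_bound[where B = 1]) auto
  finally show ?thesis
    by (simp add: integral_nonneg_AE)
qed

text \<open>Privacy compares the outputs on two fixed graphs. Integrating that comparison over a
  coupling turns it into a comparison of two random inputs, because each side of the integrated
  inequality depends on one marginal of \<open>r\<close> only.\<close>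

lemma prob_bind_coupling_le:
  assumes "\<And>x y. (x, y) \<in> set_pmf r \<Longrightarrow> measure_pmf.prob (M x) S \<le> C * measure_pmf.prob (M y) S"
  shows "measure_pmf.prob (bind_pmf (map_pmf fst r) M) S
    \<le> C * measure_pmf.prob (bind_pmf (map_pmf snd r) M) S"
proof -
  have int: "integrable (measure_pmf r) (\<lambda>z. measure_pmf.prob (M (f z)) S)" for f
    by (intro measure_pmf.integrable_const_bound[where B = 1]) auto
  have "measure_pmf.expectation r (\<lambda>z. measure_pmf.prob (M (fst z)) S)
    \<le> measure_pmf.expectation r (\<lambda>z. C * measure_pmf.prob (M (snd z)) S)"
    using assms int by (intro integral_mono_AE) (auto simp: AE_measure_pmf_iff)
  then show ?thesis
    by (simp add: prob_bind_pmf)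
qed

text \<open>Share the coordinates outside \<open>D\<close> and draw the others separately. The
  supports are recorded as well, since privacy will apply only to pairs that come from genuine
  graphs.\<close>

lemma Pi_pmf_coupling:
  assumes "finite E" and "\<And>e. e \<in> E \<Longrightarrow> e \<notin> D \<Longrightarrow> p e = q e"
  obtains r where "map_pmf fst r = Pi_pmf E d p" "map_pmf snd r = Pi_pmf E d q"
    "\<And>X Y. (X, Y) \<in> set_pmf r \<Longrightarrow> X \<in> PiE_dflt E d (\<lambda>_. UNIV) \<and> Y \<in> PiE_dflt E d (\<lambda>_. UNIV)
      \<and> (\<forall>e. e \<notin> D \<longrightarrow> X e = Y e)"
proof -
  define t where "t e = (if e \<in> D then pair_pmf (p e) (q e) else map_pmf (\<lambda>x. (x, x)) (p e))" for e
  define s where "s = Pi_pmf E (d, d) t"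
  have fst_t: "map_pmf fst (t e) = p e" for e
    by (simp add: t_def map_fst_pair_pmf pmf.map_comp o_def)
  have snd_t: "map_pmf snd (t e) = q e" if "e \<in> E" for e
    using assms(2)[OF that] by (simp add: t_def map_snd_pair_pmf pmf.map_comp o_def)
  show ?thesis
  proof (rule that[of "map_pmf (\<lambda>h. (fst \<circ> h, snd \<circ> h)) s"])
    have "Pi_pmf E d p = map_pmf (\<lambda>h. fst \<circ> h) s"
      unfolding s_def by (subst Pi_pmf_map[OF assms(1), symmetric]) (auto simp: fst_t)
    then show "map_pmf fst (map_pmf (\<lambda>h. (fst \<circ> h, snd \<circ> h)) s) = Pi_pmf E d p"
      by (simp add: pmf.map_comp o_def)
    \<comment> \<open>The shared coordinates were drawn from \<open>p\<close>, so
      \<open>snd_t\<close> is available only on \<open>E\<close>, where \<open>p\<close> and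
      \<open>q\<close> agree off \<open>D\<close>; hence the congruence over \<open>E\<close> before
      the projection is pulled out.\<close>
    have "Pi_pmf E d q = Pi_pmf E d (\<lambda>e. map_pmf snd (t e))"
      using snd_t by (intro Pi_pmf_cong) auto
    also have "\<dots> = map_pmf (\<lambda>h. snd \<circ> h) s"
      unfolding s_def by (rule Pi_pmf_map) (use assms in auto)
    finally show "map_pmf snd (map_pmf (\<lambda>h. (fst \<circ> h, snd \<circ> h)) s) = Pi_pmf E d q"
      by (simp add: pmf.map_comp o_def)
  next
    fix X Y assume "(X, Y) \<in> set_pmf (map_pmf (\<lambda>h. (fst \<circ> h, snd \<circ> h)) s)"
    then obtain h where h: "h \<in> set_pmf s" and XY: "X = fst \<circ> h" "Y = snd \<circ> h"
      by auto
    have h': "\<And>e. e \<in> E \<Longrightarrow> h e \<in> set_pmf (t e)" "\<And>e. e \<notin> E \<Longrightarrow> h e = (d, d)"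
      using h assms(1) by (auto simp: s_def set_Pi_pmf PiE_dflt_def)
    have "fst (h e) = snd (h e)" if "e \<notin> D" for e
    proof (cases "e \<in> E")
      case True
      then have "h e \<in> (\<lambda>x. (x, x)) ` set_pmf (p e)"
        using h'(1)[OF True] that by (simp add: t_def)
      then show ?thesis
        by auto
    qed (simp add: h'(2))
    then show "X \<in> PiE_dflt E d (\<lambda>_. UNIV) \<and> Y \<in> PiE_dflt E d (\<lambda>_. UNIV)
      \<and> (\<forall>e. e \<notin> D \<longrightarrow> X e = Y e)"
      using h'(2) by (auto simp: XY PiE_dflt_def)
  qed
qed

section \<open>Coupled block-model graphs and privacy across two vertices\<close>

definition edges :: "nat \<Rightarrow> (nat \<times> nat) set" where
  "edges n = {(i, j). 1 \<le> i \<and> i < j \<and> j \<le> n}"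

definition graph_of :: "(nat \<times> nat \<Rightarrow> bool) \<Rightarrow> graph" where
  "graph_of X = (\<lambda>i j. of_bool (X (min i j, max i j)))"

lemma finite_edges: "finite (edges n)"
  by (rule finite_subset[of _ "{1..n} \<times> {1..n}"]) (auto simp: edges_def)

lemma sbm_eq:
  "sbm n a b \<sigma> = map_pmf graph_of (Pi_pmf (edges n) False
     (\<lambda>(i, j). bernoulli_pmf (if \<sigma> i = \<sigma> j then a / real n else b / real n)))"
  by (simp add: sbm_def edges_def graph_of_def[abs_def])

text \<open>\<open>node_dp\<close> constrains the mechanism on \<open>graphs n\<close> only. The
  default value \<open>False\<close> off \<open>edges n\<close> is what makes the diagonal and the
  out-of-range entries vanish.\<close>

lemma graph_of_in_graphs:
  assumes "X \<in> PiE_dflt (edges n) False (\<lambda>_. UNIV)"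
  shows "graph_of X \<in> graphs n"
proof -
  have X: "\<not> X e" if "e \<notin> edges n" for e
    using assms that by (cases e) (auto simp: PiE_dflt_def)
  have "i \<in> {1..n} \<and> j \<in> {1..n}" if "X (min i j, max i j)" for i j
    using X[of "(min i j, max i j)"] that by (fastforce simp: edges_def min_def max_def split: if_splits)
  moreover have "\<not> X (i, i)" for i
    by (rule X) (simp add: edges_def)
  ultimately show ?thesis
    by (auto simp: graphs_def graph_of_def min.commute max.commute)
qed

text \<open>Group privacy for two vertices: an intermediate graph splits the change into one step
  per vertex, and each step costs a factor \<open>exp \<epsilon>\<close>.\<close>

lemma node_dp_two_nodes:
  assumes dp: "node_dp n \<epsilon> M" and uv: "u \<in> {1..n}" "v \<in> {1..n}"
    and A: "A \<in> graphs n" "A' \<in> graphs n"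
    and eq: "\<And>i j. i \<notin> {u, v} \<Longrightarrow> j \<notin> {u, v} \<Longrightarrow> A i j = A' i j"
  shows "measure_pmf.prob (M A) S \<le> exp (2 * \<epsilon>) * measure_pmf.prob (M A') S"
proof -
  \<comment> \<open>\<open>B\<close> takes the entries at \<open>u\<close> from \<open>A'\<close>
    and the rest from \<open>A\<close>. It therefore differs from \<open>A\<close> only at
    \<open>u\<close>, and from \<open>A'\<close> only at \<open>v\<close>.\<close>
  define B where "B = (\<lambda>i j. if i = u \<or> j = u then A' i j else A i j)"
  have B: "B \<in> graphs n"
    using A unfolding graphs_def B_def by auto
  have "measure_pmf.prob (M A) S \<le> exp \<epsilon> * measure_pmf.prob (M B) S"
    using dp uv A B unfolding node_dp_def node_adjacent_def by (auto simp: B_def)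
  moreover have "measure_pmf.prob (M B) S \<le> exp \<epsilon> * measure_pmf.prob (M A') S"
  proof -
    have "node_adjacent v B A'"
      using eq by (auto simp: node_adjacent_def B_def)
    then show ?thesis
      using dp uv A B unfolding node_dp_def by blast
  qed
  ultimately have "measure_pmf.prob (M A) S \<le> exp \<epsilon> * (exp \<epsilon> * measure_pmf.prob (M A') S)"
    by (meson exp_ge_zero mult_left_mono order_trans)
  then show ?thesis
    by (simp add: mult_exp_exp flip: mult.assoc)
qed

text \<open>An edge probability depends only on the labels of its two endpoints, so the two models
  disagree only on pairs that meet \<open>u\<close> or \<open>v\<close>. The coupled graphs can thus
  be chosen equal away from these two vertices.\<close>

lemma sbm_node_dp_two_labels:
  assumes dp: "node_dp n \<epsilon> M" and uv: "u \<in> {1..n}" "v \<in> {1..n}"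
    and eq: "\<And>i. i \<notin> {u, v} \<Longrightarrow> \<sigma> i = \<sigma>' i"
  shows "measure_pmf.prob (bind_pmf (sbm n a b \<sigma>) M) S
    \<le> exp (2 * \<epsilon>) * measure_pmf.prob (bind_pmf (sbm n a b \<sigma>') M) S"
proof -
  define p where
    "p = (\<lambda>\<sigma>::labeling. \<lambda>(i, j). bernoulli_pmf (if \<sigma> i = \<sigma> j then a / real n else b / real n))"
  define D where "D = {(i, j). i \<in> {u, v} \<or> j \<in> {u, v}}"
  have "p \<sigma> e = p \<sigma>' e" if "e \<notin> D" for e
    using that eq by (auto simp: p_def D_def split: prod.splits)
  then obtain r where r: "map_pmf fst r = Pi_pmf (edges n) False (p \<sigma>)"
    "map_pmf snd r = Pi_pmf (edges n) False (p \<sigma>')"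
    and sup: "\<And>X Y. (X, Y) \<in> set_pmf r \<Longrightarrow> X \<in> PiE_dflt (edges n) False (\<lambda>_. UNIV)
      \<and> Y \<in> PiE_dflt (edges n) False (\<lambda>_. UNIV) \<and> (\<forall>e. e \<notin> D \<longrightarrow> X e = Y e)"
    using Pi_pmf_coupling[OF finite_edges, of n D "p \<sigma>" "p \<sigma>'" False] by metis
  have "measure_pmf.prob (M (graph_of X)) S \<le> exp (2 * \<epsilon>) * measure_pmf.prob (M (graph_of Y)) S"
    if "(X, Y) \<in> set_pmf r" for X Y
  proof (rule node_dp_two_nodes[OF dp uv])
    show "graph_of X i j = graph_of Y i j" if "i \<notin> {u, v}" "j \<notin> {u, v}" for i j
      using sup[OF \<open>(X, Y) \<in> set_pmf r\<close>] that by (auto simp: graph_of_def D_def min_def max_def)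
  qed (use sup[OF that] graph_of_in_graphs in auto)
  \<comment> \<open>The coupling lives on edge indicators rather than graphs, so
    \<open>graph_of\<close> is absorbed into the mechanism.\<close>
  from prob_bind_coupling_le[of r "\<lambda>X. M (graph_of X)", OF this] show ?thesis
    by (simp add: sbm_eq bind_map_pmf r p_def)
qed

section \<open>Identifiability of the partition\<close>

lemma sbm_edge_marginal:
  assumes "1 \<le> i" "i < j" "j \<le> n"
  shows "map_pmf (\<lambda>A. A i j = 1) (sbm n a b \<sigma>)
    = bernoulli_pmf (if \<sigma> i = \<sigma> j then a / real n else b / real n)"
proof -
  have "(i, j) \<in> edges n"
    using assms by (simp add: edges_def)
  then show ?thesis
    using assms Pi_pmf_component[OF finite_edges, where x = "(i, j)" and dflt = False]
    by (simp add: sbm_eq pmf.map_comp o_def graph_of_def)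
qed

text \<open>The law of a single edge reveals whether its endpoints share a class, because a / n and
  b / n differ. This is needed since the representative labeling of a model is arbitrary: only its
  partition is known.\<close>

lemma sbm_identifiable:
  assumes ab: "a > b" "b \<ge> 0" "real n \<ge> a"
    and eq: "sbm n a b \<sigma> = sbm n a b \<sigma>'"
    and ij: "i \<in> {1..n}" "j \<in> {1..n}"
  shows "\<sigma> i = \<sigma> j \<longleftrightarrow> \<sigma>' i = \<sigma>' j"
proof -
  have n: "real n > 0"
    using ab by linarith
  have *: "\<sigma> i = \<sigma> j \<longleftrightarrow> \<sigma>' i = \<sigma>' j" if "1 \<le> i" "i < j" "j \<le> n" for i j
  proof -
    let ?p = "\<lambda>\<sigma>::labeling. if \<sigma> i = \<sigma> j then a / real n else b / real n"
    have "bernoulli_pmf (?p \<sigma>) = bernoulli_pmf (?p \<sigma>')"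
      using eq by (simp flip: sbm_edge_marginal[OF that])
    then have "pmf (bernoulli_pmf (?p \<sigma>)) True = pmf (bernoulli_pmf (?p \<sigma>')) True"
      by (rule arg_cong)
    \<comment> \<open>A Bernoulli law determines its parameter only within [0, 1]; here the bounds b
      >= 0 and a <= n enter.\<close>
    moreover have "0 \<le> ?p \<tau>" "?p \<tau> \<le> 1" for \<tau>
      using ab n by auto
    ultimately have "?p \<sigma> = ?p \<sigma>'"
      by simp
    then show ?thesis
      using ab n by (auto simp: field_simps split: if_splits)
  qed
  show ?thesis
    using *[of i j] *[of j i] ij by (cases i j rule: linorder_cases) auto
qed

section \<open>The mismatch loss\<close>

lemma finite_mismatches:
  fixes h :: "(nat \<Rightarrow> nat) \<Rightarrow> real"
  shows "finite (h ` {\<pi>. \<pi> permutes {1..K::nat}})" "h ` {\<pi>. \<pi> permutes {1..K}} \<noteq> {}"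
  using finite_permutations[of "{1..K}"] permutes_id[of "{1..K}"] by (auto simp del: permutes_id)

lemma mismatch_attained:
  obtains \<pi> where "\<pi> permutes {1..K}"
    "mismatch n K \<sigma> \<tau> = 1 / real n * (\<Sum>i=1..n. of_bool (\<sigma> i \<noteq> \<pi> (\<tau> i)))"
  using Min_in[OF finite_mismatches[of "\<lambda>\<pi>. 1 / real n * (\<Sum>i=1..n. of_bool (\<sigma> i \<noteq> \<pi> (\<tau> i)))" K]]
  unfolding mismatch_def by auto

lemma mismatch_nonneg: "mismatch n K \<sigma> \<tau> \<ge> 0"
  by (rule mismatch_attained[of K n \<sigma> \<tau>]) (simp add: sum_nonneg)

lemma mismatch_le_1: "mismatch n K \<sigma> \<tau> \<le> 1"
proof -
  obtain \<pi> where \<pi>: "mismatch n K \<sigma> \<tau> = 1 / real n * (\<Sum>i=1..n. of_bool (\<sigma> i \<noteq> \<pi> (\<tau> i)))"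
    using mismatch_attained by metis
  have "(\<Sum>i=1..n. of_bool (\<sigma> i \<noteq> \<pi> (\<tau> i)) :: real) \<le> (\<Sum>i=1..n. 1)"
    by (rule sum_mono) simp
  then show ?thesis
    unfolding \<pi> by (cases "n = 0") (simp_all add: divide_le_eq_1)
qed

text \<open>The mismatch is an integer count of errors divided by n, so it cannot take a value
  strictly between 0 and 1 / n.\<close>

lemma mismatch_pos_ge:
  assumes "mismatch n K \<sigma> \<tau> > 0"
  shows "mismatch n K \<sigma> \<tau> \<ge> 1 / real n"
proof -
  obtain \<pi> where \<pi>: "mismatch n K \<sigma> \<tau> = 1 / real n * (\<Sum>i=1..n. of_bool (\<sigma> i \<noteq> \<pi> (\<tau> i)))"
    using mismatch_attained by metis
  define N where "N = (\<Sum>i=1..n. of_bool (\<sigma> i \<noteq> \<pi> (\<tau> i)) :: nat)"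
  have N: "mismatch n K \<sigma> \<tau> = real N / real n"
    unfolding \<pi> N_def by simp
  with assms have "N \<ge> 1"
    by (cases N) auto
  then show ?thesis
    unfolding N by (intro divide_right_mono) auto
qed

text \<open>An optimal relabeling then makes no error, and relabeling by an injective map preserves
  the partition. Consequently no output has zero mismatch with two labelings of different
  partitions.\<close>

lemma mismatch_zero_same_partition:
  assumes "\<not> mismatch n K \<sigma> \<tau> > 0" and ij: "i \<in> {1..n}" "j \<in> {1..n}"
  shows "\<sigma> i = \<sigma> j \<longleftrightarrow> \<tau> i = \<tau> j"
proof -
  obtain \<pi> where \<pi>: "\<pi> permutes {1..K}"
    "mismatch n K \<sigma> \<tau> = 1 / real n * (\<Sum>i=1..n. of_bool (\<sigma> i \<noteq> \<pi> (\<tau> i)))"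
    by (rule mismatch_attained)
  have "mismatch n K \<sigma> \<tau> = 0"
    using assms(1) mismatch_nonneg[of n K \<sigma> \<tau>] by simp
  then have "(\<Sum>i=1..n. of_bool (\<sigma> i \<noteq> \<pi> (\<tau> i)) :: real) = 0"
    using \<pi>(2) ij by auto
  then have "\<forall>i\<in>{1..n}. \<sigma> i = \<pi> (\<tau> i)"
    by (subst (asm) sum_nonneg_eq_0_iff) auto
  then show ?thesis
    using ij inj_eq[OF permutes_inj[OF \<pi>(1)]] by simp
qed

section \<open>Swapping two labels and the lower bound on failure\<close>

lemma balanced_labelings_swap:
  assumes \<sigma>: "\<sigma> \<in> balanced_labelings n K \<beta>" and uv: "u \<in> {1..n}" "v \<in> {1..n}"
  shows "\<sigma> \<circ> Transposition.transpose u v \<in> balanced_labelings n K \<beta>"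
proof -
  have perm: "Transposition.transpose u v permutes {1..n}"
    using uv by (rule permutes_swap_id)
  have mem: "Transposition.transpose u v i \<in> {1..n} \<longleftrightarrow> i \<in> {1..n}" for i
    by (rule permutes_in_image[OF perm])
  have "card {i \<in> {1..n}. (\<sigma> \<circ> Transposition.transpose u v) i = k} = card {i \<in> {1..n}. \<sigma> i = k}" for k
  proof (rule bij_betw_same_card[of "Transposition.transpose u v"])
    show "bij_betw (Transposition.transpose u v) {i \<in> {1..n}. (\<sigma> \<circ> Transposition.transpose u v) i = k} {i \<in> {1..n}. \<sigma> i = k}"
      by (rule bij_betw_byWitness[where f' = "Transposition.transpose u v"])
        (auto simp: mem simp del: atLeastAtMost_iff One_nat_def)
  qed
  \<comment> \<open>The transposition fixes every index outside \<open>{1..n}\<close>, so the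
    default value \<open>undefined\<close> is kept there.\<close>
  moreover have "\<sigma> \<circ> Transposition.transpose u v \<in> labelings n K"
    using \<sigma> by (simp add: balanced_labelings_def labelings_def PiE_iff extensional_def mem
        del: atLeastAtMost_iff One_nat_def)
  ultimately show ?thesis
    using \<sigma> by (simp add: balanced_labelings_def)
qed

text \<open>Every output that succeeds for one model fails for the swapped one. Success has
  probability at least 1 - d under the first model, and privacy carries this event to the second,
  where it lies inside a failure event of probability at most d.\<close>

lemma failure_lower_bound:
  assumes set: "sbm_setting n K a b \<beta> \<sigma> \<epsilon> M"
    and fail: "\<And>\<theta>. \<theta> \<in> sbm_family n K a b \<beta> \<Longrightarrow>
      measure_pmf.prob (bind_pmf \<theta> M) {\<tau>. mismatch n K (\<sigma> \<theta>) \<tau> > 0} \<le> d"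
  shows "1 \<le> (1 + exp (2 * \<epsilon>)) * d"
proof -
  from set have K: "K \<ge> 2" and size: "real n / (\<beta> * real K) \<ge> 2"
    and ab: "a > b" "b \<ge> 0" "real n \<ge> a" and dp: "node_dp n \<epsilon> M"
    and choice: "\<And>\<theta>. \<theta> \<in> sbm_family n K a b \<beta> \<Longrightarrow>
      \<sigma> \<theta> \<in> balanced_labelings n K \<beta> \<and> sbm n a b (\<sigma> \<theta>) = \<theta>"
    and ne: "sbm_family n K a b \<beta> \<noteq> {}"
    by (auto simp: sbm_setting_def label_choice_def)
  from ne obtain \<theta> where \<theta>: "\<theta> \<in> sbm_family n K a b \<beta>"
    by blast
  define s where "s = \<sigma> \<theta>"
  have s: "s \<in> balanced_labelings n K \<beta>" "sbm n a b s = \<theta>"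
    using choice[OF \<theta>] by (auto simp: s_def)
  have class_size: "card {i \<in> {1..n}. s i = k} \<ge> 2" if "k \<in> {1..K}" for k
  proof -
    have "real n / (\<beta> * real K) \<le> real (card {i \<in> {1..n}. s i = k})"
      using s that unfolding balanced_labelings_def by blast
    then show ?thesis
      using size by linarith
  qed
  \<comment> \<open>\<open>w\<close> is a classmate of \<open>u\<close> that stays behind when
    \<open>u\<close> is swapped with \<open>v\<close>; the pair (u, w) will witness that the
    partition has changed.\<close>
  obtain u w where uw: "u \<in> {1..n}" "w \<in> {1..n}" "s u = 1" "s w = 1" "u \<noteq> w"
  proof -
    have "\<not> card {i \<in> {1..n}. s i = 1} \<le> Suc 0"
      using class_size[of 1] K by simp
    then show ?thesis
      using that by (subst (asm) card_le_Suc0_iff_eq) auto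
  qed
  obtain v where v: "v \<in> {1..n}" "s v = 2"
  proof -
    have "card {i \<in> {1..n}. s i = 2} > 0"
      using class_size[of 2] K by simp
    then have "{i \<in> {1..n}. s i = 2} \<noteq> {}"
      unfolding card_gt_0_iff by (rule conjunct1)
    then show ?thesis
      using that by blast
  qed
  define s' where "s' = s \<circ> Transposition.transpose u v"
  define \<theta>' where "\<theta>' = sbm n a b s'"
  have \<theta>': "\<theta>' \<in> sbm_family n K a b \<beta>"
    unfolding sbm_family_def \<theta>'_def s'_def
    using balanced_labelings_swap[OF s(1) uw(1) v(1)] by (rule imageI)
  \<comment> \<open>After the swap \<open>u\<close> carries label 2, while \<open>w\<close> is
    neither \<open>u\<close> nor \<open>v\<close> and keeps label 1.\<close>
  have "s' u \<noteq> s' w"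
    using uw v by (auto simp: s'_def Transposition.transpose_def)
  \<comment> \<open>The representative \<open>\<sigma> \<theta>'\<close> need not be
    \<open>s'\<close>; it only generates the same model, so the separation of \<open>u\<close> and
    \<open>w\<close> is transferred by identifiability.\<close>
  moreover have "sbm n a b (\<sigma> \<theta>') = sbm n a b s'"
    using choice[OF \<theta>'] by (simp add: \<theta>'_def)
  ultimately have sep: "\<sigma> \<theta>' u \<noteq> \<sigma> \<theta>' w"
    using sbm_identifiable[OF ab _ uw(1,2)] by blast
  define F where "F = (\<lambda>\<theta>. {\<tau>. mismatch n K (\<sigma> \<theta>) \<tau> > 0})"
  have disj: "- F \<theta> \<subseteq> F \<theta>'"
  proof
    fix \<tau> assume "\<tau> \<in> - F \<theta>"
    then have "s u = s w \<longleftrightarrow> \<tau> u = \<tau> w"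
      using mismatch_zero_same_partition[OF _ uw(1,2)] by (simp add: F_def s_def)
    with sep uw have "(\<sigma> \<theta>' u = \<sigma> \<theta>' w) \<noteq> (\<tau> u = \<tau> w)"
      by simp
    then show "\<tau> \<in> F \<theta>'"
      using mismatch_zero_same_partition[OF _ uw(1,2)] by (auto simp: F_def)
  qed
  have "1 - d \<le> 1 - measure_pmf.prob (bind_pmf \<theta> M) (F \<theta>)"
    using fail[OF \<theta>] by (simp add: F_def)
  also have "\<dots> = measure_pmf.prob (bind_pmf \<theta> M) (- F \<theta>)"
    using measure_pmf.prob_compl[of "F \<theta>" "bind_pmf \<theta> M"] by (simp add: Compl_eq_Diff_UNIV)
  \<comment> \<open>Privacy is applied to the success event of the first model, which is a fixed set
    of outputs.\<close>
  also have "\<dots> \<le> exp (2 * \<epsilon>) * measure_pmf.prob (bind_pmf \<theta>' M) (- F \<theta>)"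
    unfolding s(2)[symmetric] \<theta>'_def
    by (rule sbm_node_dp_two_labels[OF dp uw(1) v(1)]) (simp add: s'_def)
  also have "\<dots> \<le> exp (2 * \<epsilon>) * measure_pmf.prob (bind_pmf \<theta>' M) (F \<theta>')"
    by (intro mult_left_mono measure_pmf.finite_measure_mono disj) auto
  also have "\<dots> \<le> exp (2 * \<epsilon>) * d"
    using fail[OF \<theta>'] by (intro mult_left_mono) (auto simp: F_def)
  finally show ?thesis
    by (simp add: algebra_simps)
qed

section \<open>From suprema to single models, and from risk to failure\<close>

lemma exact_failure_upper:
  assumes "\<theta> \<in> sbm_family n K a b \<beta>"
  shows "measure_pmf.prob (bind_pmf \<theta> M) {\<tau>. mismatch n K (\<sigma> \<theta>) \<tau> > 0}
    \<le> exact_failure n K a b \<beta> \<sigma> M"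
  unfolding exact_failure_def
  by (rule cSUP_upper[OF assms]) (auto intro!: bdd_aboveI[where M = 1])

lemma integrable_mismatch: "integrable (measure_pmf p) (mismatch n K \<sigma>)"
  by (rule measure_pmf.integrable_const_bound[where B = 1])
    (auto simp: mismatch_nonneg mismatch_le_1)

lemma max_risk_upper:
  assumes "\<theta> \<in> sbm_family n K a b \<beta>"
  shows "measure_pmf.expectation (bind_pmf \<theta> M) (mismatch n K (\<sigma> \<theta>)) \<le> max_risk n K a b \<beta> \<sigma> M"
  unfolding max_risk_def
proof (rule cSUP_upper[OF assms], rule bdd_aboveI[where M = 1], clarify)
  fix \<theta>
  show "measure_pmf.expectation (bind_pmf \<theta> M) (mismatch n K (\<sigma> \<theta>)) \<le> 1"
    by (rule measure_pmf.integral_le_const[OF integrable_mismatch]) (simp add: mismatch_le_1)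
qed

text \<open>Markov's inequality at threshold 1 / n, in pointwise form: by
  \<open>mismatch_pos_ge\<close> the failure indicator is at most n times the mismatch.\<close>

lemma failure_le_risk:
  assumes "n > 0"
  shows "measure_pmf.prob p {\<tau>. mismatch n K \<sigma> \<tau> > 0}
    \<le> real n * measure_pmf.expectation p (mismatch n K \<sigma>)"
proof -
  have "measure_pmf.prob p {\<tau>. mismatch n K \<sigma> \<tau> > 0}
      = measure_pmf.expectation p (indicator {\<tau>. mismatch n K \<sigma> \<tau> > 0})"
    by simp
  also have "\<dots> \<le> measure_pmf.expectation p (\<lambda>\<tau>. real n * mismatch n K \<sigma> \<tau>)"
  proof (rule integral_mono)
    show "indicator {\<tau>. mismatch n K \<sigma> \<tau> > 0} \<tau> \<le> real n * mismatch n K \<sigma> \<tau>" for \<tau>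
      using mismatch_pos_ge[of n K \<sigma> \<tau>] mismatch_nonneg[of n K \<sigma> \<tau>] assms
      by (auto simp: indicator_def field_simps)
    show "integrable (measure_pmf p) (indicator {\<tau>. mismatch n K \<sigma> \<tau> > 0} :: _ \<Rightarrow> real)"
      by (rule measure_pmf.integrable_const_bound[where B = 1]) auto
  qed (auto intro: integrable_mismatch)
  finally show ?thesis
    by simp
qed

section \<open>Logarithmic bounds on the privacy parameter\<close>

lemma sbm_setting_n_gt_1: "sbm_setting n K a b \<beta> \<sigma> \<epsilon> M \<Longrightarrow> n > 1"
proof -
  assume "sbm_setting n K a b \<beta> \<sigma> \<epsilon> M"
  then have "K \<ge> 2" "\<beta> \<ge> 1" "real n / (\<beta> * real K) \<ge> 2"
    by (auto simp: sbm_setting_def)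
  moreover from this have "\<beta> * real K \<ge> 1 * 2"
    by (intro mult_mono) auto
  ultimately show "n > 1"
    by (simp add: pos_le_divide_eq)
qed

text \<open>For y = \<open>x powr c\<close>, the inequality y - 1 >= y / 2 is the same as y >= 2.
  For 1 < y < 2 the logarithmic inequality fails, which explains the guard on the middle inequality
  in the theorem.\<close>

lemma ln_half_bound:
  fixes x c :: real
  assumes "x > 0" "x powr c \<ge> 2"
  shows "1 / 2 * ln (x powr c - 1) \<ge> c / 2 * ln x - 1 / 2 * ln 2"
proof -
  have "ln (x powr c / 2) \<le> ln (x powr c - 1)"
    using assms by (intro ln_mono) auto
  moreover have "ln (x powr c / 2) = c * ln x - ln 2"
    using assms by (simp add: ln_div ln_powr)
  ultimately show ?thesis
    by (simp add: field_simps)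
qed

lemma epsilon_lower_bounds:
  assumes c: "c > 0" and set: "sbm_setting n K a b \<beta> \<sigma> \<epsilon> M"
    and fail: "\<And>\<theta>. \<theta> \<in> sbm_family n K a b \<beta> \<Longrightarrow>
      measure_pmf.prob (bind_pmf \<theta> M) {\<tau>. mismatch n K (\<sigma> \<theta>) \<tau> > 0} \<le> real n powr (- c)"
  shows "\<epsilon> \<ge> 1 / 2 * ln (real n powr c - 1)"
    and "\<epsilon> \<ge> c / 2 * ln (real n) - 1 / 2 * ln 2"
proof -
  have n: "n > 1"
    by (rule sbm_setting_n_gt_1[OF set])
  have "1 \<le> (1 + exp (2 * \<epsilon>)) * real n powr (- c)"
    using set fail by (rule failure_lower_bound)
  then have "real n powr c - 1 \<le> exp (2 * \<epsilon>)"
    using n by (simp add: powr_minus field_simps)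
  \<comment> \<open>Keeps the argument of the logarithm positive, so that monotonicity of
    \<open>ln\<close> applies.\<close>
  moreover have "real n powr c > 1"
    using n c by simp
  ultimately have "ln (real n powr c - 1) \<le> 2 * \<epsilon>"
    by (metis diff_gt_0_iff_gt ln_exp ln_mono)
  then show 1: "\<epsilon> \<ge> 1 / 2 * ln (real n powr c - 1)"
    by simp
  show "\<epsilon> \<ge> c / 2 * ln (real n) - 1 / 2 * ln 2"
  proof (cases "real n powr c \<ge> 2")
    case True
    then show ?thesis
      using ln_half_bound[of "real n" c] 1 n by linarith
  next
    \<comment> \<open>Here n^c < 2 makes the claimed lower bound at most 0, so positivity of
      \<open>\<epsilon>\<close> suffices and the final bound holds without the guard.\<close>
    case False
    then have "ln (real n powr c) \<le> ln 2"
      using n by (intro ln_mono) auto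
    moreover have "\<epsilon> > 0"
      using set by (simp add: sbm_setting_def node_dp_def)
    ultimately show ?thesis
      using n by (simp add: ln_powr field_simps)
  qed
qed

text \<open>The asymptotic claim runs along an arbitrary sequence of sizes tending to infinity, so
  all other parameters may vary with it; the constant depends on c alone.\<close>

lemma bigomega_ln:
  fixes \<epsilon> :: "nat \<Rightarrow> real" and n :: "nat \<Rightarrow> nat"
  assumes c: "c > 0" and n: "filterlim n at_top sequentially"
    and ev: "\<forall>\<^sub>F m in sequentially. \<epsilon> m \<ge> c / 2 * ln (real (n m)) - 1 / 2 * ln 2"
  shows "\<epsilon> \<in> \<Omega>(\<lambda>m. ln (real (n m)))"
proof (rule landau_omega.bigI)
  \<comment> \<open>Half of the slope c / 2 is given up to absorb the additive term, which works
    once ln n >= 2 ln 2 / c.\<close>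
  show "c / 4 > 0"
    using c by simp
  have "filterlim (\<lambda>m. ln (real (n m))) at_top sequentially"
    by (intro filterlim_compose[OF ln_at_top] filterlim_compose[OF filterlim_real_sequentially] n)
  \<comment> \<open>The maximum with 0 allows the norm of the logarithm to be dropped.\<close>
  then have "\<forall>\<^sub>F m in sequentially. ln (real (n m)) \<ge> max 0 (2 * ln 2 / c)"
    unfolding filterlim_at_top by blast
  with ev show "\<forall>\<^sub>F m in sequentially. norm (\<epsilon> m) \<ge> c / 4 * norm (ln (real (n m)))"
  proof eventually_elim
    case (elim m)
    then have "ln (real (n m)) \<ge> 0" "2 * ln 2 / c \<le> ln (real (n m))"
      by simp_all
    moreover from this have "2 * ln 2 \<le> c * ln (real (n m))"
      using c by (simp add: pos_divide_le_eq mult.commute)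
    moreover note elim(1)
    ultimately show ?case
      by (simp add: field_simps)
  qed
qed

theorem corollary4p3:
  fixes c :: real
  assumes c_pos: "c > 0"
  shows
    "(\<forall>(n::nat) (K::nat) (a::real) (b::real) (\<beta>::real) (\<sigma>::graph pmf \<Rightarrow> labeling) (\<epsilon>::real)
        (M::graph \<Rightarrow> labeling pmf).
      sbm_setting n K a b \<beta> \<sigma> \<epsilon> M \<longrightarrow>
      exact_failure n K a b \<beta> \<sigma> M \<le> real n powr (- c) \<longrightarrow>
      \<epsilon> \<ge> 1 / 2 * ln (real n powr c - 1) \<and>
      (real n powr c \<ge> 2 \<longrightarrow>
        1 / 2 * ln (real n powr c - 1) \<ge> c / 2 * ln (real n) - 1 / 2 * ln 2) \<and>
      \<epsilon> \<ge> c / 2 * ln (real n) - 1 / 2 * ln 2)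
    \<and>
    (\<forall>(n::nat \<Rightarrow> nat) (K::nat \<Rightarrow> nat) (a::nat \<Rightarrow> real) (b::nat \<Rightarrow> real) (\<beta>::nat \<Rightarrow> real)
        (\<sigma>::nat \<Rightarrow> graph pmf \<Rightarrow> labeling) (\<epsilon>::nat \<Rightarrow> real) (M::nat \<Rightarrow> graph \<Rightarrow> labeling pmf).
      filterlim n at_top sequentially \<longrightarrow>
      (\<forall>\<^sub>F m in sequentially. sbm_setting (n m) (K m) (a m) (b m) (\<beta> m) (\<sigma> m) (\<epsilon> m) (M m) \<and>
        exact_failure (n m) (K m) (a m) (b m) (\<beta> m) (\<sigma> m) (M m) \<le> real (n m) powr (- c)) \<longrightarrow>
      \<epsilon> \<in> \<Omega>(\<lambda>m. ln (real (n m))))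
    \<and>
    (\<forall>(n::nat) (K::nat) (a::real) (b::real) (\<beta>::real) (\<sigma>::graph pmf \<Rightarrow> labeling) (\<epsilon>::real)
        (M::graph \<Rightarrow> labeling pmf).
      sbm_setting n K a b \<beta> \<sigma> \<epsilon> M \<longrightarrow>
      max_risk n K a b \<beta> \<sigma> M \<le> real n powr (- (1 + c)) \<longrightarrow>
      \<epsilon> \<ge> 1 / 2 * ln (real n powr c - 1) \<and>
      (real n powr c \<ge> 2 \<longrightarrow>
        1 / 2 * ln (real n powr c - 1) \<ge> c / 2 * ln (real n) - 1 / 2 * ln 2) \<and>
      \<epsilon> \<ge> c / 2 * ln (real n) - 1 / 2 * ln 2)
    \<and>
    (\<forall>(n::nat \<Rightarrow> nat) (K::nat \<Rightarrow> nat) (a::nat \<Rightarrow> real) (b::nat \<Rightarrow> real) (\<beta>::nat \<Rightarrow> real)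
        (\<sigma>::nat \<Rightarrow> graph pmf \<Rightarrow> labeling) (\<epsilon>::nat \<Rightarrow> real) (M::nat \<Rightarrow> graph \<Rightarrow> labeling pmf).
      filterlim n at_top sequentially \<longrightarrow>
      (\<forall>\<^sub>F m in sequentially. sbm_setting (n m) (K m) (a m) (b m) (\<beta> m) (\<sigma> m) (\<epsilon> m) (M m) \<and>
        max_risk (n m) (K m) (a m) (b m) (\<beta> m) (\<sigma> m) (M m) \<le> real (n m) powr (- (1 + c))) \<longrightarrow>
      \<epsilon> \<in> \<Omega>(\<lambda>m. ln (real (n m))))"
proof -
  have fail: "\<epsilon> \<ge> 1 / 2 * ln (real n powr c - 1)"
    "\<epsilon> \<ge> c / 2 * ln (real n) - 1 / 2 * ln 2"
    if "sbm_setting n K a b \<beta> \<sigma> \<epsilon> M" "exact_failure n K a b \<beta> \<sigma> M \<le> real n powr (- c)"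
    for n K a b \<beta> \<sigma> \<epsilon> M
    using epsilon_lower_bounds[OF c_pos that(1)] order_trans[OF exact_failure_upper that(2)]
    by blast+
  have risk: "exact_failure n K a b \<beta> \<sigma> M \<le> real n powr (- c)"
    if "sbm_setting n K a b \<beta> \<sigma> \<epsilon> M" "max_risk n K a b \<beta> \<sigma> M \<le> real n powr (- (1 + c))"
    for n K a b \<beta> \<sigma> \<epsilon> M
    unfolding exact_failure_def
  proof (rule cSUP_least)
    \<comment> \<open>Bounding a real supremum through its members requires a nonempty
      family.\<close>
    show "sbm_family n K a b \<beta> \<noteq> {}"
      using that(1) by (simp add: sbm_setting_def)
    fix \<theta> assume \<theta>: "\<theta> \<in> sbm_family n K a b \<beta>"
    have n: "n > 0"
      using sbm_setting_n_gt_1[OF that(1)] by simp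
    have "measure_pmf.prob (bind_pmf \<theta> M) {\<tau>. mismatch n K (\<sigma> \<theta>) \<tau> > 0}
        \<le> real n * measure_pmf.expectation (bind_pmf \<theta> M) (mismatch n K (\<sigma> \<theta>))"
      by (rule failure_le_risk[OF n])
    also have "\<dots> \<le> real n * real n powr (- (1 + c))"
      using order_trans[OF max_risk_upper[OF \<theta>] that(2)] by (intro mult_left_mono) auto
    \<comment> \<open>The factor n lost to Markov's inequality is exactly the extra 1 in the
      exponent 1 + c.\<close>
    also have "\<dots> = real n powr (- c)"
      using n by (simp add: powr_mult_base)
    finally show "measure_pmf.prob (bind_pmf \<theta> M) {\<tau>. mismatch n K (\<sigma> \<theta>) \<tau> > 0}
        \<le> real n powr (- c)" .
  qed
  have bounds: "\<epsilon> \<ge> 1 / 2 * ln (real n powr c - 1) \<and>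
      (real n powr c \<ge> 2 \<longrightarrow>
        1 / 2 * ln (real n powr c - 1) \<ge> c / 2 * ln (real n) - 1 / 2 * ln 2) \<and>
      \<epsilon> \<ge> c / 2 * ln (real n) - 1 / 2 * ln 2"
    if "sbm_setting n K a b \<beta> \<sigma> \<epsilon> M" "exact_failure n K a b \<beta> \<sigma> M \<le> real n powr (- c)"
    for n K a b \<beta> \<sigma> \<epsilon> M
    using fail[OF that] ln_half_bound[of "real n" c] sbm_setting_n_gt_1[OF that(1)] by simp
  show ?thesis
  proof (rule conjI[OF _ conjI[OF _ conjI]], goal_cases)
    case 1
    show ?case
      by (intro allI impI) (rule bounds)
  next
    case 2
    show ?case
      by (intro allI impI, rule bigomega_ln[OF c_pos], assumption, erule eventually_mono)
        (blast intro: fail(2))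
  next
    case 3
    show ?case
      by (intro allI impI) (rule bounds[OF _ risk])
  next
    case 4
    show ?case
      by (intro allI impI, rule bigomega_ln[OF c_pos], assumption, erule eventually_mono)
        (blast intro: fail(2) risk)
  qed
qed

end
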